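(* Consider the linear dynamical system $x(t+1)=Ax(t)+Bu(t)$, $x(0)=x_0$, $t\in\mathbb{N}_0$, with $A\in\mathbb{R}^{n\times n}$, $B\in\mathbb{R}^{n\times m}$. Suppose that the binary-valued process $\{l(i)\in\{0,1\}\}_{i\in\mathbb{N}_0}$ characterizing packet exchange failures in the network satisfies, with $L(k)\triangleq\sum_{i=0}^{k-1}l(i)$ and a scalar $\rho\in[0,1]$, $$\limsup_{k\to\infty}\frac{L(k)}{k}\le\rho\quad\text{almost surely.}$$ If there exist a matrix $K\in\mathbb{R}^{m\times n}$, a positive-definite matrix $P\in\mathbb{R}^{n\times n}$, and scalars $\beta\in(0,1)$, $\varphi\in[1,\infty)$ such that $$(A+BK)^{\mathrm T}P(A+BK)-\beta P\le 0,\qquad A^{\mathrm T}PA-\varphi P\le 0,\qquad (1-\rho)\ln\beta+\rho\ln\varphi<0,$$ then the event-triggered control law with parameters $K,P,\beta$ and $\theta\in\mathbb{N}$ (defined in the context) guarantees almost sure asymptotic stability of the zero solution $x(t)\equiv 0$ of the closed-loop system dynamics.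
   Context: $\mathbb{N}$ and $\mathbb{N}_0$ denote the positive and nonnegative integers; $\|\cdot\|$ is the Euclidean norm; matrix inequalities are in the semidefinite sense for symmetric matrices; $\mathbb{P}$ is the probability on the underlying probability space. Closed-loop system. In the plant $x(t+1)=Ax(t)+Bu(t)$, $x(t)\in\mathbb{R}^n$ is the state and $u(t)\in\mathbb{R}^m$ the control input. Packet exchanges between plant and controller are attempted at times $\tau_0<\tau_1<\cdots$ in $\mathbb{N}_0$; $l(i)=1$ means that the attempt at $\tau_i$ fails and $l(i)=0$ that it succeeds. The control input is $$u(t)=(1-l(i))Kx(\tau_i),\quad t\in\{\tau_i,\ldots,\tau_{i+1}-1\},\ i\in\mathbb{N}_0.$$ The attempt times are determined by the event-triggering rule: with $V(x)\triangleq x^{\mathrm T}Px$, $\tau_0=0$ and $$\tau_{i+1}\triangleq\min\{t\in\{\tau_i+1,\tau_i+2,\ldots\}: t\ge\tau_i+\theta\ \text{ or }\ V(Ax(t)+Bu(\tau_i))>\beta V(x(\tau_i))\},$$ where $\theta\in\mathbb{N}$. Stability. The zero solution $x(t)\equiv0$ is almost surely stable if for all $\epsilon>0$ and $\bar p>0$ there exists $\delta=\delta(\epsilon,\bar p)>0$ such that if $\|x(0)\|<\delta$, then $\mathbb{P}[\sup_{t\in\mathbb{N}_0}\|x(t)\|>\epsilon]<\bar p$. It is asymptotically stable almost surely if it is almost surely stable and $\mathbb{P}[\lim_{t\to\infty}\|x(t)\|=0]=1$. *)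

theory Defs
  imports "HOL-Probability.Probability"
begin

definition pos_def_matrix :: "real^'n^'n \<Rightarrow> bool" where
  "pos_def_matrix P \<longleftrightarrow> transpose P = P \<and> (\<forall>v. v \<noteq> 0 \<longrightarrow> v \<bullet> (P *v v) > 0)"

definition neg_semidef_matrix :: "real^'n^'n \<Rightarrow> bool" where
  "neg_semidef_matrix Q \<longleftrightarrow> transpose Q = Q \<and> (\<forall>v. v \<bullet> (Q *v v) \<le> 0)"

definition lyap :: "real^'n^'n \<Rightarrow> real^'n \<Rightarrow> real" where
  "lyap P v = v \<bullet> (P *v v)"

text \<open>
  One sample path of the closed loop: failure indicators \<open>l\<close>, states \<open>x\<close>, inputs \<open>u\<close> and
  attempt times \<open>\<tau>\<close>. For \<open>\<theta> \<ge> 1\<close> the set of which the next attempt time is the least element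
  contains \<open>\<tau> i + \<theta>\<close>. By \<open>closed_loop_exists\<close> below, every failure sequence and every
  initial state admit such a path.
\<close>
definition closed_loop ::
  "real^'n^'n \<Rightarrow> real^'m^'n \<Rightarrow> real^'n^'m \<Rightarrow> real^'n^'n \<Rightarrow> real \<Rightarrow> nat \<Rightarrow>
   (nat \<Rightarrow> nat) \<Rightarrow> (nat \<Rightarrow> real^'n) \<Rightarrow> (nat \<Rightarrow> real^'m) \<Rightarrow> (nat \<Rightarrow> nat) \<Rightarrow> bool" where
  "closed_loop A B K P \<beta> \<theta> l x u \<tau> \<longleftrightarrow>
     (\<forall>t. x (Suc t) = A *v x t + B *v u t) \<and>
     (\<forall>i. \<forall>t\<in>{\<tau> i..<\<tau> (Suc i)}. u t = (1 - real (l i)) *\<^sub>R (K *v x (\<tau> i))) \<and>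
     \<tau> 0 = 0 \<and>
     (\<forall>i. \<tau> (Suc i) = (LEAST t. t \<ge> \<tau> i + 1 \<and>
        (t \<ge> \<tau> i + \<theta> \<or> lyap P (A *v x t + B *v u (\<tau> i)) > \<beta> * lyap P (x (\<tau> i)))))"

text \<open>
  In the stability notions, \<open>x x0 t \<omega>\<close> is the state at time \<open>t\<close> of the solution with initial
  state \<open>x0\<close> along the sample point \<open>\<omega>\<close>. The supremum is taken in the extended reals since it
  may be infinite, and the event is required to be measurable because \<open>measure\<close> is \<open>0\<close> on
  non-measurable sets.
\<close>
definition almost_surely_stable ::
  "'w measure \<Rightarrow> (real^'n \<Rightarrow> nat \<Rightarrow> 'w \<Rightarrow> real^'n) \<Rightarrow> bool" where
  "almost_surely_stable M x \<longleftrightarrow>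
     (\<forall>\<epsilon>>0. \<forall>p>0. \<exists>\<delta>>0. \<forall>x0. norm (x0 :: real^'n) < \<delta> \<longrightarrow>
        {\<omega> \<in> space M. (SUP t. ereal (norm (x x0 t \<omega>))) > ereal \<epsilon>} \<in> sets M \<and>
        measure M {\<omega> \<in> space M. (SUP t. ereal (norm (x x0 t \<omega>))) > ereal \<epsilon>} < p)"

definition asymptotically_stable_almost_surely ::
  "'w measure \<Rightarrow> (real^'n \<Rightarrow> nat \<Rightarrow> 'w \<Rightarrow> real^'n) \<Rightarrow> bool" where
  "asymptotically_stable_almost_surely M x \<longleftrightarrow>
     almost_surely_stable M x \<and>
     (\<forall>x0. measure M {\<omega> \<in> space M. (\<lambda>t. norm (x x0 t \<omega>)) \<longlonglongrightarrow> 0} = 1)"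

lemma closed_loop_exists:
  fixes A :: "real^'n^'n" and B :: "real^'m^'n" and K :: "real^'n^'m" and P :: "real^'n^'n"
  assumes "\<theta> \<ge> 1"
  shows "\<exists>x u \<tau>. closed_loop A B K P \<beta> \<theta> l x u \<tau> \<and> x 0 = x0"
proof -
  define c where "c i y = (1 - real (l i)) *\<^sub>R (K *v y)" for i and y :: "real^'n"
  define h where "h i y d = ((\<lambda>z. A *v z + B *v c i y) ^^ d) y" for i y d
  define Q where "Q i y d \<longleftrightarrow> d \<ge> 1 \<and>
    (d \<ge> \<theta> \<or> lyap P (A *v h i y d + B *v c i y) > \<beta> * lyap P y)" for i y d
  define D where "D i y = (LEAST d. Q i y d)" for i y
  define s where "s = rec_nat (0::nat, x0) (\<lambda>i (t, y). (t + D i y, h i y (D i y)))"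
  define \<tau> where "\<tau> i = fst (s i)" for i
  define y where "y i = snd (s i)" for i
  have s0: "\<tau> 0 = 0" "y 0 = x0" by (simp_all add: \<tau>_def y_def s_def)
  have sS: "\<tau> (Suc i) = \<tau> i + D i (y i)" "y (Suc i) = h i (y i) (D i (y i))" for i
    by (simp_all add: \<tau>_def y_def s_def split: prod.split)
  have "Q i z \<theta>" for i z using assms by (simp add: Q_def)
  hence QD: "Q i z (D i z)" for i z unfolding D_def by (rule LeastI)
  hence D1: "D i z \<ge> 1" for i z by (auto simp: Q_def)
  have mono: "strict_mono \<tau>"
    using D1 by (intro strict_mono_Suc_iff[THEN iffD2] allI)
      (metis sS(1) less_add_same_cancel1 less_le_trans zero_less_one)
  define I where "I t = (GREATEST i. \<tau> i \<le> t)" for t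
  have I: "I t = i" if "\<tau> i \<le> t" "t < \<tau> (Suc i)" for i t
    unfolding I_def
  proof (rule Greatest_equality)
    fix j assume "\<tau> j \<le> t"
    with that have "\<tau> j < \<tau> (Suc i)" by simp
    thus "j \<le> i" using mono by (simp add: strict_mono_less)
  qed fact
  have ex: "\<exists>i. \<tau> i \<le> t \<and> t < \<tau> (Suc i)" for t
  proof (induction t)
    case 0
    show ?case using s0 D1[of 0 "y 0"] sS(1)[of 0] by (intro exI[of _ 0]) simp
  next
    case (Suc t)
    then obtain i where i: "\<tau> i \<le> t" "t < \<tau> (Suc i)" by blast
    show ?case
    proof (cases "Suc t < \<tau> (Suc i)")
      case True with i show ?thesis by (intro exI[of _ i]) simp
    next
      case False
      with i have "Suc t = \<tau> (Suc i)" by simp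
      moreover have "\<tau> (Suc i) < \<tau> (Suc (Suc i))" using mono by (simp add: strict_mono_less)
      ultimately show ?thesis by (intro exI[of _ "Suc i"]) simp
    qed
  qed
  define x where "x t = h (I t) (y (I t)) (t - \<tau> (I t))" for t
  define u where "u t = c (I t) (y (I t))" for t
  have less: "\<tau> i < \<tau> (Suc i)" for i using mono by (simp add: strict_mono_less)
  have xi: "x t = h i (y i) (t - \<tau> i)" if "\<tau> i \<le> t" "t \<le> \<tau> (Suc i)" for i t
  proof (cases "t = \<tau> (Suc i)")
    case True
    have "I t = Suc i" using I[of "Suc i" t] less True by simp
    thus ?thesis using True by (simp add: x_def sS) (simp add: h_def)
  next
    case False
    hence "I t = i" using that by (intro I) auto
    thus ?thesis by (simp add: x_def)
  qed
  have ui: "u t = c i (y i)" if "\<tau> i \<le> t" "t < \<tau> (Suc i)" for i t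
    using I[OF that] by (simp add: u_def)
  have x\<tau>: "x (\<tau> i) = y i" for i using xi[of i "\<tau> i"] less[of i] by (simp add: h_def)
  have "x (Suc t) = A *v x t + B *v u t" for t
  proof -
    obtain i where i: "\<tau> i \<le> t" "t < \<tau> (Suc i)" using ex by blast
    thus ?thesis using xi[of i t] xi[of i "Suc t"] ui[of i t]
      by (simp add: h_def Suc_diff_le)
  qed
  moreover have "\<tau> (Suc i) = (LEAST t. t \<ge> \<tau> i + 1 \<and>
        (t \<ge> \<tau> i + \<theta> \<or> lyap P (A *v x t + B *v u (\<tau> i)) > \<beta> * lyap P (x (\<tau> i))))"
    (is "_ = (LEAST t. ?R t)") for i
  proof -
    have eq: "?R t \<longleftrightarrow> Q i (y i) (t - \<tau> i)" if "\<tau> i \<le> t" "t \<le> \<tau> (Suc i)" for t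
      using xi[OF that] ui[of i "\<tau> i"] less[of i] x\<tau>[of i] that by (auto simp: Q_def)
    have "?R (\<tau> (Suc i))" using eq[of "\<tau> (Suc i)"] QD[of i "y i"] sS(1)[of i] by simp
    moreover have "\<tau> (Suc i) \<le> t" if "?R t" for t
    proof (rule ccontr)
      assume "\<not> \<tau> (Suc i) \<le> t"
      with eq[of t] that have "Q i (y i) (t - \<tau> i)" by auto
      hence "D i (y i) \<le> t - \<tau> i" unfolding D_def by (rule Least_le)
      with \<open>\<not> \<tau> (Suc i) \<le> t\<close> that sS(1)[of i] show False by auto
    qed
    ultimately show ?thesis by (intro Least_equality[symmetric])
  qed
  ultimately have "closed_loop A B K P \<beta> \<theta> l x u \<tau>"
    unfolding closed_loop_def using s0 ui x\<tau> by (auto simp: c_def)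
  moreover have "x 0 = x0" using x\<tau>[of 0] s0 by simp
  ultimately show ?thesis by blast
qed

end

theory Submission
  imports Defs
begin

text \<open>
  Between two attempts, \<open>V = lyap P\<close> stays below \<open>\<beta>\<close> times its value at the last attempt if that
  attempt succeeded: the first step contracts because of \<open>A + B K\<close>, and each later step would have
  triggered a new attempt otherwise. After a failed attempt the same argument gives the factor
  \<open>\<phi>\<close>. Hence \<open>V\<close> at and after the \<open>k\<close>-th attempt is at most \<open>\<phi> \<beta>^(k - L k) \<phi>^(L k) V(x0)\<close>, and the bound on
  \<open>limsup L k / k\<close> makes this gain decay exponentially almost surely. As the gain does not depend
  on \<open>x0\<close>, its supremum is an almost surely finite random variable whose tail probability yields
  \<open>\<delta>\<close> in the definition of almost sure stability.
  Measurability of the state at time \<open>t\<close> holds because it is determined by the finitely many values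
  \<open>l 0, ..., l (t - 1)\<close>.
\<close>

section \<open>Quadratic form estimates for \<open>lyap P\<close>\<close>

text \<open>Moving \<open>C\<close> across the inner product turns the quadratic form of
  \<open>transpose C ** P ** C\<close> at \<open>v\<close> into \<open>lyap P (C *v v)\<close>. This
  converts both matrix inequalities of the theorem into one-step bounds on the Lyapunov
  function.\<close>

lemma lyap_matrix_le:
  assumes "neg_semidef_matrix (transpose C ** P ** C - c *\<^sub>R P)"
  shows "lyap P (C *v v) \<le> c * lyap P v"
proof -
  have "v \<bullet> ((transpose C ** P ** C - c *\<^sub>R P) *v v) \<le> 0"
    using assms by (simp add: neg_semidef_matrix_def)
  moreover have "(transpose C ** P ** C) *v v = (P *v (C *v v)) v* C"
    by (simp only: matrix_vector_mul_assoc[symmetric] transpose_matrix_vector)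
  hence "v \<bullet> ((transpose C ** P ** C) *v v) = lyap P (C *v v)"
    by (metis lyap_def inner_commute dot_lmul_matrix)
  moreover have "v \<bullet> ((c *\<^sub>R P) *v v) = c * lyap P v"
    by (simp add: lyap_def scaleR_matrix_vector_assoc[symmetric])
  ultimately show ?thesis
    by (simp add: matrix_vector_mult_diff_rdistrib inner_diff_right)
qed

lemma lyap_nonneg:
  assumes "pos_def_matrix P"
  shows "0 \<le> lyap P v"
  using assms by (cases "v = 0") (auto simp: lyap_def pos_def_matrix_def less_imp_le)

lemma lyap_upper_bound:
  fixes P :: "real^'n^'n"
  obtains b where "b > 0" "\<And>v. lyap P v \<le> b * (norm v)\<^sup>2"
proof -
  obtain b where b: "b > 0" "\<And>v. norm (P *v v) \<le> norm v * b"
    using bounded_linear.pos_bounded[OF matrix_vector_mul_bounded_linear[of P]] by blast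
  have "lyap P v \<le> b * (norm v)\<^sup>2" for v
  proof -
    have "lyap P v \<le> norm v * norm (P *v v)"
      by (simp add: lyap_def norm_cauchy_schwarz)
    also have "\<dots> \<le> norm v * (norm v * b)"
      using b(2) by (intro mult_left_mono) auto
    finally show ?thesis by (simp add: power2_eq_square mult_ac)
  qed
  with b(1) that show ?thesis by blast
qed

text \<open>The form attains its minimum on the compact unit sphere, that minimum is positive by
  definiteness, and homogeneity of degree two extends the bound to all vectors.\<close>

lemma lyap_lower_bound:
  fixes P :: "real^'n^'n"
  assumes "pos_def_matrix P"
  obtains a where "a > 0" "\<And>v. a * (norm v)\<^sup>2 \<le> lyap P v"
proof -
  have "continuous_on (sphere 0 1) (lyap P)"
    unfolding lyap_def
    by (intro continuous_intros linear_continuous_on matrix_vector_mul_bounded_linear)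
  moreover have "sphere (0 :: real^'n) 1 \<noteq> {}" by simp
  ultimately obtain w :: "real^'n"
    where w: "w \<in> sphere 0 1" "\<And>v. v \<in> sphere 0 1 \<Longrightarrow> lyap P w \<le> lyap P v"
    using continuous_attains_inf[of "sphere 0 1" "lyap P"] by auto
  have "w \<noteq> 0" using w(1) by auto
  hence "lyap P w > 0" using assms by (simp add: pos_def_matrix_def lyap_def)
  moreover have "lyap P w * (norm v)\<^sup>2 \<le> lyap P v" for v
  proof (cases "v = 0")
    case True thus ?thesis by (simp add: lyap_def)
  next
    case False
    hence "lyap P w \<le> lyap P ((1 / norm v) *\<^sub>R v)" by (intro w(2)) simp
    also have "\<dots> = lyap P v / (norm v)\<^sup>2"
      by (simp add: lyap_def power2_eq_square matrix_vector_mult_scaleR)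
    finally show ?thesis using False by (simp add: field_simps)
  qed
  ultimately show ?thesis using that by blast
qed

section \<open>Exchange times and causality of a sample path\<close>

lemma closed_loopD:
  assumes "closed_loop A B K P \<beta> \<theta> l x u \<tau>"
  shows "x (Suc t) = A *v x t + B *v u t"
    and "\<tau> i \<le> t \<Longrightarrow> t < \<tau> (Suc i) \<Longrightarrow> u t = (1 - real (l i)) *\<^sub>R (K *v x (\<tau> i))"
    and "\<tau> 0 = 0"
  using assms unfolding closed_loop_def by (blast, metis atLeastLessThan_iff, blast)

text \<open>The candidate \<open>\<tau> i + \<theta>\<close> shows that the minimum is attained. The
  equivalence covers times up to and including the minimum: the triggering rule holds there and
  fails at every time strictly in between.\<close>

lemma closed_loop_next_attempt:
  assumes "closed_loop A B K P \<beta> \<theta> l x u \<tau>" "\<theta> \<ge> 1"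
  shows "\<tau> i < \<tau> (Suc i)"
    and "\<tau> i < t \<Longrightarrow> t \<le> \<tau> (Suc i) \<Longrightarrow> t = \<tau> (Suc i) \<longleftrightarrow>
      t \<ge> \<tau> i + \<theta> \<or> lyap P (A *v x t + B *v u (\<tau> i)) > \<beta> * lyap P (x (\<tau> i))"
proof -
  define R where "R t \<longleftrightarrow> t \<ge> \<tau> i + 1 \<and>
    (t \<ge> \<tau> i + \<theta> \<or> lyap P (A *v x t + B *v u (\<tau> i)) > \<beta> * lyap P (x (\<tau> i)))" for t
  have \<tau>: "\<tau> (Suc i) = (LEAST t. R t)"
    using assms(1) unfolding closed_loop_def R_def by blast
  have "R (\<tau> i + \<theta>)" using assms(2) by (simp add: R_def)
  hence R: "R (\<tau> (Suc i))" unfolding \<tau> by (rule LeastI)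
  have least: "\<tau> (Suc i) \<le> t" if "R t" for t
    unfolding \<tau> using that by (rule Least_le)
  show "\<tau> i < \<tau> (Suc i)" using R by (simp add: R_def)
  assume t: "\<tau> i < t" "t \<le> \<tau> (Suc i)"
  hence "t = \<tau> (Suc i) \<longleftrightarrow> R t" using R least by (metis le_antisym)
  thus "t = \<tau> (Suc i) \<longleftrightarrow>
      t \<ge> \<tau> i + \<theta> \<or> lyap P (A *v x t + B *v u (\<tau> i)) > \<beta> * lyap P (x (\<tau> i))"
    using t(1) by (simp add: R_def)
qed

text \<open>Strict growth gives \<open>i \<le> \<tau> i\<close>, so only finitely many indices have
  \<open>\<tau> i \<le> t\<close>; the largest of them is the witness.\<close>

lemma strict_mono_nat_interval:
  fixes \<tau> :: "nat \<Rightarrow> nat"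
  assumes "strict_mono \<tau>" "\<tau> 0 = 0"
  obtains i where "\<tau> i \<le> t" "t < \<tau> (Suc i)"
proof -
  have "i \<le> t" if "\<tau> i \<le> t" for i
    using that seq_suble[OF assms(1), of i] by simp
  hence "{i. \<tau> i \<le> t} \<subseteq> {..t}" by auto
  hence fin: "finite {i. \<tau> i \<le> t}" by (rule finite_subset) simp
  let ?i = "Max {i. \<tau> i \<le> t}"
  have "?i \<in> {i. \<tau> i \<le> t}" using fin assms(2) by (intro Max_in) (auto intro: exI[of _ 0])
  moreover have "\<not> \<tau> (Suc ?i) \<le> t" using Max_ge[OF fin, of "Suc ?i"] by auto
  ultimately show ?thesis using that by simp
qed

text \<open>Causality: consecutive exchanges are at least one time step apart, so the state at time
  \<open>n\<close> can depend only on the first \<open>n\<close> outcomes. This is the source of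
  measurability of the state.\<close>

lemma closed_loop_unique:
  assumes cl: "closed_loop A B K P \<beta> \<theta> l x u \<tau>" and cl': "closed_loop A B K P \<beta> \<theta> l' x' u' \<tau>'"
    and "\<theta> \<ge> 1" and "x 0 = x' 0" and l: "\<And>i. i < n \<Longrightarrow> l i = l' i"
  shows "x n = x' n"
proof -
  note nx = closed_loop_next_attempt[OF cl \<open>\<theta> \<ge> 1\<close>]
  note nx' = closed_loop_next_attempt[OF cl' \<open>\<theta> \<ge> 1\<close>]
  note step = closed_loopD(1)[OF cl] closed_loopD(1)[OF cl']
  note inp = closed_loopD(2)[OF cl] and inp' = closed_loopD(2)[OF cl']
  note \<tau>0 = closed_loopD(3)[OF cl] closed_loopD(3)[OF cl']
  \<comment> \<open>Both paths have agreed so far and share the current interval index and its left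
    end; the right ends are only known to exceed \<open>t\<close>, as they are decided
    later.\<close>
  have "t \<le> n \<Longrightarrow> \<exists>i. i \<le> t \<and> \<tau> i = \<tau>' i \<and> \<tau> i \<le> t \<and> t < \<tau> (Suc i) \<and> t < \<tau>' (Suc i)
    \<and> (\<forall>s\<le>t. x s = x' s)" for t
  proof (induction t)
    case 0
    show ?case using \<tau>0 nx(1)[of 0] nx'(1)[of 0] \<open>x 0 = x' 0\<close> by (intro exI[of _ 0]) auto
  next
    case (Suc t)
    then obtain i where i: "i \<le> t" "\<tau> i = \<tau>' i" "\<tau> i \<le> t" "t < \<tau> (Suc i)" "t < \<tau>' (Suc i)"
      and xs: "\<And>s. s \<le> t \<Longrightarrow> x s = x' s" by auto
    \<comment> \<open>The invariant \<open>i \<le> t\<close> matters here: together with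
      \<open>t < n\<close> it places \<open>i\<close> among the indices where the outcomes
      coincide.\<close>
    have li: "l i = l' i" using i(1) Suc.prems by (intro l) simp
    have ueq: "u s = u' s" if "\<tau> i \<le> s" "s \<le> t" for s
      using inp[of i s] inp'[of i s] that i xs[of "\<tau> i"] li by simp
    have "x (Suc t) = x' (Suc t)" using step(1,2)[of t] ueq[of t] xs[of t] i by simp
    hence xs': "\<And>s. s \<le> Suc t \<Longrightarrow> x s = x' s" using xs by (metis le_Suc_eq)
    \<comment> \<open>The triggering test at \<open>Suc t\<close> only involves the state at that
      time and data from time \<open>\<tau> i\<close>, all of which are already identified.\<close>
    have "Suc t = \<tau> (Suc i) \<longleftrightarrow> Suc t = \<tau>' (Suc i)"
      using nx(2)[of i "Suc t"] nx'(2)[of i "Suc t"] i ueq[of "\<tau> i"] xs'[of "Suc t"] xs'[of "\<tau> i"]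
      by simp
    then consider "Suc t = \<tau> (Suc i)" "Suc t = \<tau>' (Suc i)"
      | "Suc t < \<tau> (Suc i)" "Suc t < \<tau>' (Suc i)"
      using i by linarith
    thus ?case
    proof cases
      case 1
      thus ?thesis using i xs' nx(1)[of "Suc i"] nx'(1)[of "Suc i"]
        by (intro exI[of _ "Suc i"]) auto
    next
      case 2
      thus ?thesis using i xs' by (intro exI[of _ i]) auto
    qed
  qed
  thus ?thesis by auto
qed

section \<open>The gain and its decay along exchanges\<close>

text \<open>
  This is \<open>\<beta>^(k - L k) * \<phi>^(L k)\<close> with \<open>L k = (\<Sum>i<k. l i)\<close>, written as an exponential so that
  failure rates translate into linear bounds on the exponent.
\<close>
definition gain :: "real \<Rightarrow> real \<Rightarrow> (nat \<Rightarrow> nat) \<Rightarrow> nat \<Rightarrow> real" where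
  "gain \<beta> \<phi> l k = exp ((real k - real (\<Sum>i<k. l i)) * ln \<beta> + real (\<Sum>i<k. l i) * ln \<phi>)"

lemma gain_0: "gain \<beta> \<phi> l 0 = 1"
  by (simp add: gain_def)

lemma gain_Suc:
  assumes "0 < \<beta>" "0 < \<phi>" "l k \<in> {0, 1}"
  shows "gain \<beta> \<phi> l (Suc k) = (if l k = 0 then \<beta> else \<phi>) * gain \<beta> \<phi> l k"
proof -
  have "gain \<beta> \<phi> l (Suc k) = exp ((1 - real (l k)) * ln \<beta> + real (l k) * ln \<phi>) * gain \<beta> \<phi> l k"
    by (simp add: gain_def exp_add[symmetric] algebra_simps)
  thus ?thesis using assms by auto
qed

lemma gain_pos: "0 < gain \<beta> \<phi> l k"
  by (simp add: gain_def)

text \<open>With \<open>S\<close> the number of failures before \<open>k\<close>, the exponent is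
  \<open>k * ln \<beta> + S * D\<close>, where \<open>D > 0\<close>. The failure rate is eventually
  below some \<open>r\<close> slightly above \<open>\<rho>\<close>, and the strict inequality leaves
  room for that excess.\<close>

lemma gain_tendsto_0:
  assumes "0 < \<beta>" "\<beta> < 1" "1 \<le> \<phi>" "(1 - \<rho>) * ln \<beta> + \<rho> * ln \<phi> < 0"
    and lim: "limsup (\<lambda>k. ereal (real (\<Sum>i<k. l i) / real k)) \<le> ereal \<rho>"
  shows "gain \<beta> \<phi> l \<longlonglongrightarrow> 0"
proof -
  define D where "D = ln \<phi> - ln \<beta>"
  define c where "c = - ((1 - \<rho>) * ln \<beta> + \<rho> * ln \<phi>)"
  have "D > 0" "c > 0" using assms ln_ge_zero[of \<phi>] ln_less_zero[of \<beta>] by (auto simp: D_def c_def)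
  \<comment> \<open>Chosen to spend half of the margin \<open>c\<close>:
    \<open>ln \<beta> + r * D = - c / 2\<close>.\<close>
  define r where "r = \<rho> + c / (2 * D)"
  have "\<rho> < r" using \<open>D > 0\<close> \<open>c > 0\<close> by (simp add: r_def)
  hence "limsup (\<lambda>k. ereal (real (\<Sum>i<k. l i) / real k)) < ereal r"
    by (intro le_less_trans[OF lim]) simp
  hence "\<forall>\<^sub>F k in sequentially. ereal (real (\<Sum>i<k. l i) / real k) < ereal r"
    by (rule Limsup_lessD)
  hence ev: "\<forall>\<^sub>F k in sequentially. gain \<beta> \<phi> l k \<le> exp (- c / 2) ^ k"
    using eventually_gt_at_top[of 0]
  proof eventually_elim
    case (elim k)
    let ?S = "real (\<Sum>i<k. l i)"
    have "?S \<le> r * real k" using elim by (simp add: divide_less_eq)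
    hence "?S * D \<le> r * real k * D" using \<open>D > 0\<close> by (intro mult_right_mono) auto
    also have "r * real k * D = real k * (\<rho> * D + c / 2)"
      using \<open>D > 0\<close> by (simp add: r_def field_simps)
    finally have "real k * ln \<beta> + ?S * D \<le> real k * (ln \<beta> + \<rho> * D + c / 2)"
      by (simp add: algebra_simps)
    also have "ln \<beta> + \<rho> * D + c / 2 = - c / 2" by (simp add: D_def c_def field_simps)
    finally have "(real k - ?S) * ln \<beta> + ?S * ln \<phi> \<le> real k * (- c / 2)"
      by (simp add: D_def algebra_simps)
    thus ?case by (simp only: gain_def exp_of_nat_mult[symmetric] exp_le_cancel_iff)
  qed
  have "(\<lambda>k. exp (- c / 2) ^ k) \<longlonglongrightarrow> 0"
    using \<open>c > 0\<close> by (intro LIMSEQ_realpow_zero) auto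
  thus ?thesis
    by (intro tendsto_sandwich[OF always_eventually ev tendsto_const])
      (simp add: gain_pos less_imp_le)
qed

text \<open>Each interval multiplies the bound by \<open>\<beta>\<close> or \<open>\<phi>\<close>
  according to its outcome. The extra factor \<open>\<phi>\<close> covers every time inside interval
  \<open>k\<close>, whatever \<open>l k\<close> is.\<close>

lemma closed_loop_lyap_bound:
  assumes cl: "closed_loop A B K P \<beta> \<theta> l x u \<tau>" and "\<theta> \<ge> 1"
    and l: "\<And>i. l i \<in> {0, 1}" and P: "pos_def_matrix P" and \<beta>: "0 < \<beta>" "\<beta> < 1" and \<phi>: "1 \<le> \<phi>"
    and AK: "neg_semidef_matrix (transpose (A + B ** K) ** P ** (A + B ** K) - \<beta> *\<^sub>R P)"
    and AA: "neg_semidef_matrix (transpose A ** P ** A - \<phi> *\<^sub>R P)"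
  shows "\<tau> k \<le> t \<Longrightarrow> t \<le> \<tau> (Suc k) \<Longrightarrow> lyap P (x t) \<le> \<phi> * gain \<beta> \<phi> l k * lyap P (x 0)"
proof -
  note nx = closed_loop_next_attempt[OF cl \<open>\<theta> \<ge> 1\<close>]
  note step = closed_loopD(1)[OF cl] and inp = closed_loopD(2)[OF cl]
  have g: "(if l i = 0 then \<beta> else \<phi>) \<ge> \<beta>" "(if l i = 0 then \<beta> else \<phi>) \<le> \<phi>" for i
    using \<beta> \<phi> by auto
  have within: "lyap P (x t) \<le> (if l i = 0 then \<beta> else \<phi>) * lyap P (x (\<tau> i))"
    if t: "\<tau> i < t" "t \<le> \<tau> (Suc i)" for i t
  proof -
    obtain s where s: "t = Suc s" "\<tau> i \<le> s" "s < \<tau> (Suc i)"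
      using t by (cases t) auto
    have us: "u s = u (\<tau> i)" using inp[of i s] inp[of i "\<tau> i"] s nx(1)[of i] by simp
    show ?thesis
    \<comment> \<open>The triggering rule is not tested at \<open>\<tau> i\<close> itself, so the
      first step rests on the matrix inequalities.\<close>
    proof (cases "s = \<tau> i")
      case True
      have "l i = 0 \<or> l i = 1" using l[of i] by blast
      thus ?thesis
      proof
        assume "l i = 0"
        hence "x t = (A + B ** K) *v x (\<tau> i)"
          using s True step[of s] inp[of i s]
          by (simp add: matrix_vector_mult_add_rdistrib matrix_vector_mul_assoc)
        thus ?thesis using lyap_matrix_le[OF AK] \<open>l i = 0\<close> by simp
      next
        assume "l i = 1"
        hence "x t = A *v x (\<tau> i)" using s True step[of s] inp[of i s] by simp
        thus ?thesis using lyap_matrix_le[OF AA] \<open>l i = 1\<close> by simp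
      qed
    next
      case False
      \<comment> \<open>Here \<open>s\<close> lies strictly between two exchanges, so the triggering
        condition fails at \<open>s\<close>; as the input is held constant, the vector tested there
        is exactly \<open>x (Suc s)\<close>.\<close>
      hence "lyap P (x t) \<le> \<beta> * lyap P (x (\<tau> i))"
        using nx(2)[of i s] s step[of s] us by simp
      also have "\<dots> \<le> (if l i = 0 then \<beta> else \<phi>) * lyap P (x (\<tau> i))"
        using g(1) lyap_nonneg[OF P] by (intro mult_right_mono)
      finally show ?thesis .
    qed
  qed
  have attempts: "lyap P (x (\<tau> i)) \<le> gain \<beta> \<phi> l i * lyap P (x 0)" for i
  proof (induction i)
    case 0
    show ?case by (simp add: gain_0 closed_loopD(3)[OF cl])
  next
    case (Suc i)
    have "lyap P (x (\<tau> (Suc i))) \<le> (if l i = 0 then \<beta> else \<phi>) * lyap P (x (\<tau> i))"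
      using nx(1)[of i] by (intro within) auto
    also have "\<dots> \<le> (if l i = 0 then \<beta> else \<phi>) * (gain \<beta> \<phi> l i * lyap P (x 0))"
      using Suc.IH \<beta> \<phi> by (intro mult_left_mono) auto
    also have "\<dots> = gain \<beta> \<phi> l (Suc i) * lyap P (x 0)"
      using gain_Suc[of \<beta> \<phi> l i] \<beta> \<phi> l[of i] by simp
    finally show ?case .
  qed
  assume t: "\<tau> k \<le> t" "t \<le> \<tau> (Suc k)"
  have "lyap P (x t) \<le> \<phi> * lyap P (x (\<tau> k))"
  proof (cases "t = \<tau> k")
    case True
    thus ?thesis using \<phi> lyap_nonneg[OF P, of "x (\<tau> k)"] mult_right_mono[of 1 \<phi>] by simp
  next
    case False
    hence "lyap P (x t) \<le> (if l k = 0 then \<beta> else \<phi>) * lyap P (x (\<tau> k))"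
      using t by (intro within) auto
    also have "\<dots> \<le> \<phi> * lyap P (x (\<tau> k))"
      using g(2) lyap_nonneg[OF P] by (intro mult_right_mono)
    finally show ?thesis .
  qed
  also have "\<dots> \<le> \<phi> * (gain \<beta> \<phi> l k * lyap P (x 0))"
    using attempts \<phi> by (intro mult_left_mono) auto
  finally show "lyap P (x t) \<le> \<phi> * gain \<beta> \<phi> l k * lyap P (x 0)" by (simp add: mult.assoc)
qed

section \<open>Measurability and tail probabilities\<close>

text \<open>Such an \<open>f\<close> factors through the finite set of binary words of length
  \<open>n\<close>, so the preimage of any set is a finite union of measurable cylinders.\<close>

lemma measurable_finite_history:
  fixes l :: "nat \<Rightarrow> 'w \<Rightarrow> nat"
  assumes l: "\<And>i. l i \<in> measurable M (count_space {0, 1})"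
    and f: "\<And>\<omega> \<omega>'. \<omega> \<in> space M \<Longrightarrow> \<omega>' \<in> space M \<Longrightarrow> (\<And>i. i < n \<Longrightarrow> l i \<omega> = l i \<omega>') \<Longrightarrow> f \<omega> = f \<omega>'"
    and sp: "\<And>\<omega>. \<omega> \<in> space M \<Longrightarrow> f \<omega> \<in> space N"
  shows "f \<in> measurable M N"
proof (rule measurableI)
  fix Y
  \<comment> \<open>The cylinder of all sample points sharing their first \<open>n\<close> outcomes
    with \<open>\<omega>\<close>.\<close>
  define H where "H \<omega> = {\<omega>' \<in> space M. \<forall>i<n. l i \<omega>' = l i \<omega>}" for \<omega>
  have H: "H \<omega> \<in> sets M" for \<omega>
  proof -
    have "l i \<in> measurable M (count_space UNIV)" for i
      by (rule measurable_compose[OF l]) simp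
    note [measurable] = this
    show ?thesis unfolding H_def by measurable
  qed
  have "H ` space M \<subseteq> (\<lambda>g. {\<omega>' \<in> space M. \<forall>i<n. l i \<omega>' = g i}) ` ({..<n} \<rightarrow>\<^sub>E {0, 1})"
  proof
    fix h assume "h \<in> H ` space M"
    then obtain \<omega> where \<omega>: "\<omega> \<in> space M" "h = H \<omega>" by auto
    have "l i \<omega> \<in> {0, 1}" for i using measurable_space[OF l \<omega>(1)] by simp
    thus "h \<in> (\<lambda>g. {\<omega>' \<in> space M. \<forall>i<n. l i \<omega>' = g i}) ` ({..<n} \<rightarrow>\<^sub>E {0, 1})"
      by (intro image_eqI[of _ _ "\<lambda>i\<in>{..<n}. l i \<omega>"]) (auto simp: \<omega>(2) H_def)
  qed
  hence "finite (H ` space M)"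
    by (rule finite_subset) (intro finite_imageI finite_PiE; simp)
  hence "finite (H ` (f -` Y \<inter> space M))" by (rule finite_subset[rotated]) auto
  hence "\<Union> (H ` (f -` Y \<inter> space M)) \<in> sets M" using H by (intro sets.finite_Union) auto
  also have "\<Union> (H ` (f -` Y \<inter> space M)) = f -` Y \<inter> space M"
  proof (intro equalityI subsetI)
    fix \<omega> assume "\<omega> \<in> \<Union> (H ` (f -` Y \<inter> space M))"
    then obtain \<omega>' where "\<omega>' \<in> space M" "f \<omega>' \<in> Y" "\<omega> \<in> H \<omega>'" by auto
    thus "\<omega> \<in> f -` Y \<inter> space M" using f[of \<omega> \<omega>'] by (auto simp: H_def)
  qed (auto simp: H_def)
  finally show "f -` Y \<inter> space M \<in> sets M" .
qed (rule sp)

text \<open>Continuity from above: the events of exceeding growing thresholds decrease to the event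
  of unboundedness, which is null.\<close>

lemma (in prob_space) tail_prob_less:
  fixes g :: "nat \<Rightarrow> 'a \<Rightarrow> real"
  assumes [measurable]: "\<And>k. g k \<in> borel_measurable M"
    and bdd: "AE \<omega> in M. bdd_above (range (\<lambda>k. g k \<omega>))" and "0 < p"
  obtains c where "c > 0" "{\<omega> \<in> space M. \<exists>k. g k \<omega> > c} \<in> sets M"
    "prob {\<omega> \<in> space M. \<exists>k. g k \<omega> > c} < p"
proof -
  \<comment> \<open>Using \<open>Suc j\<close> instead of \<open>j\<close> keeps the threshold
    positive.\<close>
  define E where "E j = {\<omega> \<in> space M. \<exists>k. g k \<omega> > real (Suc j)}" for j
  have E: "E j \<in> events" for j unfolding E_def by measurable
  have "E j \<subseteq> E i" if "i \<le> j" for i j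
  proof -
    have "real (Suc i) \<le> real (Suc j)" using that by simp
    thus ?thesis unfolding E_def by (blast intro: le_less_trans)
  qed
  hence "decseq E" by (rule antimonoI)
  moreover have "range E \<subseteq> events" using E by auto
  ultimately have lim: "(\<lambda>j. prob (E j)) \<longlonglongrightarrow> prob (\<Inter>j. E j)"
    by (intro finite_Lim_measure_decseq)
  have "AE \<omega> in M. \<omega> \<notin> (\<Inter>j. E j)"
    using bdd
  proof eventually_elim
    case (elim \<omega>)
    then obtain b where b: "\<And>k. g k \<omega> \<le> b" by (auto simp: bdd_above_def)
    obtain j where "b \<le> real j" using real_arch_simple by blast
    hence "g k \<omega> \<le> real (Suc j)" for k using b[of k] by simp
    hence "\<omega> \<notin> E j" by (simp add: E_def not_less)
    thus ?case by auto
  qed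
  hence "prob (\<Inter>j. E j) = 0"
    using E by (subst prob_eq_0) auto
  with lim have "\<forall>\<^sub>F j in sequentially. prob (E j) < p"
    using \<open>0 < p\<close> by (intro order_tendstoD(2)[of _ 0]) auto
  then obtain j where "prob (E j) < p" by (auto simp: eventually_sequentially)
  thus ?thesis using that[of "real (Suc j)"] E[of j] by (simp add: E_def)
qed

section \<open>Almost sure stability and convergence of the state\<close>

theorem theorem3p5:
  fixes A :: "real^'n^'n" and B :: "real^'m^'n" and K :: "real^'n^'m" and P :: "real^'n^'n"
    and \<rho> \<beta> \<phi> :: real and \<theta> :: nat
    and M :: "'w measure" and l :: "nat \<Rightarrow> 'w \<Rightarrow> nat" and L :: "nat \<Rightarrow> 'w \<Rightarrow> nat"
    and x :: "real^'n \<Rightarrow> nat \<Rightarrow> 'w \<Rightarrow> real^'n"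
    and u :: "real^'n \<Rightarrow> nat \<Rightarrow> 'w \<Rightarrow> real^'m"
    and \<tau> :: "real^'n \<Rightarrow> nat \<Rightarrow> 'w \<Rightarrow> nat"
  assumes "prob_space M"
    and "\<And>i. l i \<in> measurable M (count_space {0, 1})"
    and "\<And>k \<omega>. L k \<omega> = (\<Sum>i<k. l i \<omega>)"
    and "0 \<le> \<rho>" and "\<rho> \<le> 1"
    and "AE \<omega> in M. limsup (\<lambda>k. ereal (real (L k \<omega>) / real k)) \<le> ereal \<rho>"
    and "pos_def_matrix P"
    and "0 < \<beta>" and "\<beta> < 1" and "1 \<le> \<phi>"
    and "neg_semidef_matrix (transpose (A + B ** K) ** P ** (A + B ** K) - \<beta> *\<^sub>R P)"
    and "neg_semidef_matrix (transpose A ** P ** A - \<phi> *\<^sub>R P)"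
    and "(1 - \<rho>) * ln \<beta> + \<rho> * ln \<phi> < 0"
    and "1 \<le> \<theta>"
    and "\<And>x0 \<omega>. \<omega> \<in> space M \<Longrightarrow> x x0 0 \<omega> = x0"
    and "\<And>x0 \<omega>. \<omega> \<in> space M \<Longrightarrow>
           closed_loop A B K P \<beta> \<theta> (\<lambda>i. l i \<omega>) (\<lambda>t. x x0 t \<omega>) (\<lambda>t. u x0 t \<omega>) (\<lambda>i. \<tau> x0 i \<omega>)"
  shows "asymptotically_stable_almost_surely M x"
proof -
  interpret prob_space M by fact
  note lm = assms(2) and P = \<open>pos_def_matrix P\<close>
  define G where "G k \<omega> = gain \<beta> \<phi> (\<lambda>i. l i \<omega>) k" for k \<omega>
  have l01: "l i \<omega> \<in> {0, 1}" if "\<omega> \<in> space M" for i \<omega>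
    using measurable_space[OF lm that] by simp
  \<comment> \<open>The solution family is arbitrary; its measurability follows from
    causality.\<close>
  have xm [measurable]: "x x0 t \<in> borel_measurable M" for x0 t
  proof (rule measurable_finite_history[OF lm, where n = t])
    fix \<omega> \<omega>'
    assume \<omega>: "\<omega> \<in> space M" "\<omega>' \<in> space M" "\<And>i. i < t \<Longrightarrow> l i \<omega> = l i \<omega>'"
    show "x x0 t \<omega> = x x0 t \<omega>'"
      by (rule closed_loop_unique[OF assms(16)[OF \<omega>(1)] assms(16)[OF \<omega>(2)] assms(14)])
        (simp_all add: assms(15) \<omega>)
  qed simp
  have Gm: "G k \<in> borel_measurable M" for k
  proof (rule measurable_finite_history[OF lm, where n = k])
    fix \<omega> \<omega>'
    assume "\<And>i. i < k \<Longrightarrow> l i \<omega> = l i \<omega>'"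
    hence "(\<Sum>i<k. l i \<omega>) = (\<Sum>i<k. l i \<omega>')" by (intro sum.cong) auto
    thus "G k \<omega> = G k \<omega>'" by (simp only: G_def gain_def)
  qed simp
  have G0: "AE \<omega> in M. (\<lambda>k. G k \<omega>) \<longlonglongrightarrow> 0"
    using assms(6)
  proof eventually_elim
    case (elim \<omega>)
    thus ?case using gain_tendsto_0[OF assms(8-10,13), of "\<lambda>i. l i \<omega>"]
      by (simp add: G_def assms(3))
  qed
  obtain a where a: "a > 0" "\<And>v. a * (norm v)\<^sup>2 \<le> lyap P v" using lyap_lower_bound[OF P] by blast
  obtain b where b: "b > 0" "\<And>v. lyap P v \<le> b * (norm v)\<^sup>2" using lyap_upper_bound[of P] by blast
  \<comment> \<open>Collects the cost of passing between the Lyapunov function and the squared norm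
    at both ends of the estimate.\<close>
  define q where "q = \<phi> * b / a"
  have "q > 0" using a b assms(10) by (simp add: q_def)
  have norm_le: "(norm (x x0 t \<omega>))\<^sup>2 \<le> q * G k \<omega> * (norm x0)\<^sup>2"
    if "\<omega> \<in> space M" "\<tau> x0 k \<omega> \<le> t" "t \<le> \<tau> x0 (Suc k) \<omega>" for x0 t \<omega> k
  proof -
    have "a * (norm (x x0 t \<omega>))\<^sup>2 \<le> lyap P (x x0 t \<omega>)" by (rule a)
    also have "\<dots> \<le> \<phi> * G k \<omega> * lyap P (x x0 0 \<omega>)"
      unfolding G_def
      using closed_loop_lyap_bound[OF assms(16)[OF that(1)] assms(14) l01[OF that(1)] P assms(8-12)]
        that by blast
    also have "\<dots> \<le> \<phi> * G k \<omega> * (b * (norm x0)\<^sup>2)"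
      using b(2)[of x0] assms(10) assms(15)[OF that(1), of x0]
      by (intro mult_left_mono) (auto simp: G_def gain_pos less_imp_le)
    finally show ?thesis using a(1) by (simp add: q_def field_simps)
  qed
  have mono: "strict_mono (\<lambda>i. \<tau> x0 i \<omega>)" and \<tau>0: "\<tau> x0 0 \<omega> = 0" if "\<omega> \<in> space M" for x0 \<omega>
    using closed_loop_next_attempt(1)[OF assms(16)[OF that] assms(14)]
      closed_loopD(3)[OF assms(16)[OF that]] by (simp_all add: strict_mono_Suc_iff)
  have interval: "\<exists>k. \<tau> x0 k \<omega> \<le> t \<and> t < \<tau> x0 (Suc k) \<omega>" if "\<omega> \<in> space M" for x0 t \<omega>
    using strict_mono_nat_interval[OF mono \<tau>0, OF that that] by metis
  have stable: "almost_surely_stable M x"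
    unfolding almost_surely_stable_def
  proof (intro allI impI)
    fix \<epsilon> p :: real assume "0 < \<epsilon>" "0 < p"
    have "AE \<omega> in M. bdd_above (range (\<lambda>k. G k \<omega>))"
      using G0 by eventually_elim (intro bounded_imp_bdd_above convergent_imp_bounded)
    then obtain c where c: "c > 0" "{\<omega> \<in> space M. \<exists>k. G k \<omega> > c} \<in> events"
      "prob {\<omega> \<in> space M. \<exists>k. G k \<omega> > c} < p"
      using tail_prob_less[of G p] Gm \<open>0 < p\<close> by blast
    \<comment> \<open>Solves \<open>q * c * \<delta>\<^sup>2 = \<epsilon>\<^sup>2\<close>;
      \<open>c\<close> bounds the gain outside an event of probability below \<open>p\<close> and
      does not depend on \<open>x0\<close>.\<close>
    define \<delta> where "\<delta> = \<epsilon> / sqrt (q * c)"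
    have "\<delta> > 0" using \<open>\<epsilon> > 0\<close> \<open>q > 0\<close> c(1) by (simp add: \<delta>_def)
    moreover have "{\<omega> \<in> space M. (SUP t. ereal (norm (x x0 t \<omega>))) > ereal \<epsilon>} \<in> sets M \<and>
      prob {\<omega> \<in> space M. (SUP t. ereal (norm (x x0 t \<omega>))) > ereal \<epsilon>} < p"
      if "norm x0 < \<delta>" for x0
    proof -
      \<comment> \<open>A supremum exceeds \<open>\<epsilon>\<close> strictly exactly when some term
        does, which makes the event a countable union.\<close>
      have eq: "{\<omega> \<in> space M. (SUP t. ereal (norm (x x0 t \<omega>))) > ereal \<epsilon>} =
        {\<omega> \<in> space M. \<exists>t. norm (x x0 t \<omega>) > \<epsilon>}"
        by (auto simp: less_SUP_iff)
      have "{\<omega> \<in> space M. \<exists>t. norm (x x0 t \<omega>) > \<epsilon>} \<subseteq> {\<omega> \<in> space M. \<exists>k. G k \<omega> > c}"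
      proof safe
        fix \<omega> t assume \<omega>: "\<omega> \<in> space M" "\<epsilon> < norm (x x0 t \<omega>)"
        obtain k where k: "\<tau> x0 k \<omega> \<le> t" "t < \<tau> x0 (Suc k) \<omega>" using interval[OF \<omega>(1)] by blast
        have "G k \<omega> > c"
        proof (rule ccontr)
          assume "\<not> G k \<omega> > c"
          have "(norm (x x0 t \<omega>))\<^sup>2 \<le> q * G k \<omega> * (norm x0)\<^sup>2"
            using norm_le[OF \<omega>(1)] k by simp
          also have "\<dots> \<le> q * c * \<delta>\<^sup>2"
            using \<open>\<not> G k \<omega> > c\<close> that \<open>q > 0\<close> c(1)
            by (intro mult_mono power_mono mult_left_mono) auto
          also have "\<dots> = \<epsilon>\<^sup>2"
            using \<open>q > 0\<close> c(1) by (simp add: \<delta>_def power_divide)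
          finally show False using \<omega>(2) \<open>\<epsilon> > 0\<close> by (simp add: power2_le_iff_abs_le)
        qed
        thus "\<exists>k. G k \<omega> > c" ..
      qed
      moreover have "{\<omega> \<in> space M. \<exists>t. norm (x x0 t \<omega>) > \<epsilon>} \<in> events" by measurable
      ultimately show ?thesis
        unfolding eq using finite_measure_mono[OF _ c(2)] c(3) by (blast intro: le_less_trans)
    qed
    ultimately show "\<exists>\<delta>>0. \<forall>x0. norm x0 < \<delta> \<longrightarrow>
      {\<omega> \<in> space M. (SUP t. ereal (norm (x x0 t \<omega>))) > ereal \<epsilon>} \<in> sets M \<and>
      prob {\<omega> \<in> space M. (SUP t. ereal (norm (x x0 t \<omega>))) > ereal \<epsilon>} < p" by blast
  qed
  have "AE \<omega> in M. (\<lambda>t. norm (x x0 t \<omega>)) \<longlonglongrightarrow> 0" for x0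
    using G0 AE_space
  proof eventually_elim
    case (elim \<omega>)
    have "(\<lambda>t. (norm (x x0 t \<omega>))\<^sup>2) \<longlonglongrightarrow> 0"
    proof (rule LIMSEQ_I)
      fix r :: real assume "r > 0"
      have "(\<lambda>k. q * G k \<omega> * (norm x0)\<^sup>2) \<longlonglongrightarrow> q * 0 * (norm x0)\<^sup>2"
        by (intro tendsto_intros elim)
      hence "\<forall>\<^sub>F k in sequentially. q * G k \<omega> * (norm x0)\<^sup>2 < r"
        using \<open>r > 0\<close> by (intro order_tendstoD(2)[of _ 0]) auto
      then obtain N where N: "\<And>k. k \<ge> N \<Longrightarrow> q * G k \<omega> * (norm x0)\<^sup>2 < r"
        by (auto simp: eventually_sequentially)
      have "(norm (x x0 t \<omega>))\<^sup>2 < r" if t: "t \<ge> \<tau> x0 N \<omega>" for t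
      proof -
        obtain k where k: "\<tau> x0 k \<omega> \<le> t" "t < \<tau> x0 (Suc k) \<omega>" using interval[OF elim(2)] by blast
        \<comment> \<open>Times after exchange \<open>N\<close> lie in intervals of index at least
          \<open>N\<close>, which transfers decay in \<open>k\<close> to decay in
          \<open>t\<close>.\<close>
        with t have "\<tau> x0 N \<omega> < \<tau> x0 (Suc k) \<omega>" by simp
        hence "N \<le> k" using strict_mono_less[OF mono[OF elim(2)]] by simp
        thus ?thesis using norm_le[OF elim(2), of x0 k t] k N[of k] by simp
      qed
      thus "\<exists>n0. \<forall>n\<ge>n0. norm ((norm (x x0 n \<omega>))\<^sup>2 - 0) < r" by auto
    qed
    hence "(\<lambda>t. sqrt ((norm (x x0 t \<omega>))\<^sup>2)) \<longlonglongrightarrow> sqrt 0" by (rule tendsto_real_sqrt)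
    thus ?case by simp
  qed
  moreover have "{\<omega> \<in> space M. (\<lambda>t. norm (x x0 t \<omega>)) \<longlonglongrightarrow> 0} \<in> events" for x0
    by measurable
  ultimately have "prob {\<omega> \<in> space M. (\<lambda>t. norm (x x0 t \<omega>)) \<longlonglongrightarrow> 0} = 1" for x0
    by (subst prob_Collect_eq_1) auto
  with stable show ?thesis by (simp add: asymptotically_stable_almost_surely_def)
qed

end
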